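(* Let $\mathcal{D}[t]$ be a Fréchet space with conjugate dual $\mathcal{D}^\times$, let $(X,\mu)$ be a measure space with $\mu$ a $\sigma$-finite positive measure, and let $\omega: x\in X\mapsto\omega_x\in\mathcal{D}^\times$ be a Riesz-Fischer distribution map. Put $\omega^\bot:=\{g\in\mathcal{D}: \langle g|\omega_x\rangle=0\ \text{for } \mu\text{-a.e. } x\in X\}$. Then for every continuous seminorm $p$ on $\mathcal{D}$ there exists a constant $C>0$ such that, for every $h\in L^2(X,\mu)$ and every solution $f\in\mathcal{D}$ of the equation $\langle f|\omega_x\rangle=h(x)$ $\mu$-a.e., $$\tilde{p}(\tilde{f}):=\inf\{p(g): g\in f+\omega^\bot\}\le C\,\|\langle f|\omega_x\rangle\|_2 ,$$ where $\|\langle f|\omega_x\rangle\|_2$ is the $L^2(X,\mu)$-norm of the function $x\mapsto\langle f|\omega_x\rangle$.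
   Context: For a locally convex space $\mathcal{D}[t]$, $\mathcal{D}^\times$ denotes the conjugate dual, i.e. the vector space of all continuous conjugate linear functionals on $\mathcal{D}[t]$. For $F\in\mathcal{D}^\times$ and $f\in\mathcal{D}$, $\langle F|f\rangle$ denotes the value of $F$ at $f$, and $\langle f|F\rangle:=\overline{\langle F|f\rangle}$ (which is linear in $f$). A map $\omega: X\to\mathcal{D}^\times$, $x\mapsto\omega_x$, is weakly measurable if for every $f\in\mathcal{D}$ the complex valued function $x\mapsto\langle f|\omega_x\rangle$ is $\mu$-measurable. A weakly measurable map $\omega$ is a Riesz-Fischer distribution map (Riesz-Fischer map) if for every $h\in L^2(X,\mu)$ there exists $f\in\mathcal{D}$ such that $\langle f|\omega_x\rangle=h(x)$ for $\mu$-a.e. $x\in X$; such an $f$ is called a solution of the equation $\langle f|\omega_x\rangle=h(x)$. For $f\in\mathcal{D}$, $\tilde{f}:=f+\omega^\bot$ denotes its class in the quotient space $\mathcal{D}/\omega^\bot$. *)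

theory Defs
  imports "HOL-Analysis.Analysis" "HOL-Library.Set_Algebras"
begin

text \<open>
  HOL-Analysis has no type class for complex topological vector spaces, so the scalar
  multiplication and the topology are explicit parameters; the underlying vector space is the
  whole type.
\<close>

locale complex_locally_convex_space = vector_space smul
  for smul :: "complex \<Rightarrow> 'a::ab_group_add \<Rightarrow> 'a" +
  fixes T :: "'a topology"
  assumes topspace_UNIV: "topspace T = UNIV"
    and continuous_add: "continuous_map (prod_topology T T) T (\<lambda>(x, y). x + y)"
    and continuous_scale: "continuous_map (prod_topology euclidean T) T (\<lambda>(c, x). smul c x)"
    and convex_local_base:
      "\<And>U. openin T U \<Longrightarrow> 0 \<in> U \<Longrightarrow>
        \<exists>V. openin T V \<and> 0 \<in> V \<and> V \<subseteq> U \<and>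
          (\<forall>x\<in>V. \<forall>y\<in>V. \<forall>s::real. 0 \<le> s \<and> s \<le> 1 \<longrightarrow>
            smul (of_real (1 - s)) x + smul (of_real s) y \<in> V)"

text \<open>
  Completeness is a property of the uniform structure, not of the topology alone.  It is expressed
  through a translation-invariant metric, whose Cauchy sequences are those of the topological
  vector space.
\<close>

locale complex_frechet_space = complex_locally_convex_space smul T
  for smul :: "complex \<Rightarrow> 'a::ab_group_add \<Rightarrow> 'a" and T :: "'a topology" +
  assumes complete_invariant_metric:
    "\<exists>d. Metric_space UNIV d \<and> (\<forall>x y z. d (x + z) (y + z) = d x y) \<and>
         Metric_space.mtopology UNIV d = T \<and> Metric_space.mcomplete UNIV d"

definition continuous_seminorm ::
  "(complex \<Rightarrow> 'a::ab_group_add \<Rightarrow> 'a) \<Rightarrow> 'a topology \<Rightarrow> ('a \<Rightarrow> real) \<Rightarrow> bool" where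
  "continuous_seminorm smul T p \<longleftrightarrow>
     (\<forall>x. 0 \<le> p x) \<and> (\<forall>x y. p (x + y) \<le> p x + p y) \<and>
     (\<forall>c x. p (smul c x) = cmod c * p x) \<and> continuous_map T euclideanreal p"

definition conj_dual ::
  "(complex \<Rightarrow> 'a::ab_group_add \<Rightarrow> 'a) \<Rightarrow> 'a topology \<Rightarrow> ('a \<Rightarrow> complex) set" where
  "conj_dual smul T =
     {F. (\<forall>x y. F (x + y) = F x + F y) \<and> (\<forall>c x. F (smul c x) = cnj c * F x) \<and>
         continuous_map T euclidean F}"

text \<open>\<open>bra f F\<close> is $\langle f|F\rangle$, the conjugate of the value of \<open>F\<close> at \<open>f\<close>.\<close>

definition bra :: "'a \<Rightarrow> ('a \<Rightarrow> complex) \<Rightarrow> complex" where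
  "bra f F = cnj (F f)"

definition weakly_measurable_map ::
  "(complex \<Rightarrow> 'a::ab_group_add \<Rightarrow> 'a) \<Rightarrow> 'a topology \<Rightarrow> 'x measure \<Rightarrow> ('x \<Rightarrow> 'a \<Rightarrow> complex) \<Rightarrow> bool" where
  "weakly_measurable_map smul T M \<omega> \<longleftrightarrow>
     (\<forall>x\<in>space M. \<omega> x \<in> conj_dual smul T) \<and>
     (\<forall>f. (\<lambda>x. bra f (\<omega> x)) \<in> borel_measurable M)"

text \<open>
  \<open>L2_functions\<close> and \<open>L2_norm\<close> work with representatives; almost-everywhere equal functions are
  not identified.
\<close>

definition L2_functions :: "'x measure \<Rightarrow> ('x \<Rightarrow> complex) set" where
  "L2_functions M = {h \<in> borel_measurable M. integrable M (\<lambda>x. (cmod (h x))\<^sup>2)}"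

definition L2_norm :: "'x measure \<Rightarrow> ('x \<Rightarrow> complex) \<Rightarrow> real" where
  "L2_norm M h = sqrt (LINT x|M. (cmod (h x))\<^sup>2)"

definition is_solution ::
  "'x measure \<Rightarrow> ('x \<Rightarrow> 'a \<Rightarrow> complex) \<Rightarrow> ('x \<Rightarrow> complex) \<Rightarrow> 'a \<Rightarrow> bool" where
  "is_solution M \<omega> h f \<longleftrightarrow> (AE x in M. bra f (\<omega> x) = h x)"

definition riesz_fischer_map ::
  "(complex \<Rightarrow> 'a::ab_group_add \<Rightarrow> 'a) \<Rightarrow> 'a topology \<Rightarrow> 'x measure \<Rightarrow> ('x \<Rightarrow> 'a \<Rightarrow> complex) \<Rightarrow> bool" where
  "riesz_fischer_map smul T M \<omega> \<longleftrightarrow>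
     weakly_measurable_map smul T M \<omega> \<and> (\<forall>h\<in>L2_functions M. \<exists>f. is_solution M \<omega> h f)"

definition orth :: "'x measure \<Rightarrow> ('x \<Rightarrow> 'a \<Rightarrow> complex) \<Rightarrow> 'a set" where
  "orth M \<omega> = {g. AE x in M. bra g (\<omega> x) = 0}"

definition quotient_seminorm :: "('a \<Rightarrow> real) \<Rightarrow> 'a set \<Rightarrow> real" where
  "quotient_seminorm p A = (INF g\<in>A. p g)"

end

theory Submission
  imports Defs
begin

text \<open>
  The proof is an open mapping argument for the map sending $f$ to
  $x \mapsto \langle f|\omega_x\rangle$, whose range contains $L^2$. Since $L^2$ is complete, the image
  of some multiple of a neighbourhood of $0$ is dense in a ball; taking differences and scaling, the
  image of every neighbourhood is dense in a ball around $0$. Successive approximation in the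
  complete space \<open>'a\<close> then yields exact solutions: the partial sums converge in \<open>T\<close>, hence pointwise
  after pairing with each $\omega_x$, while their images converge almost everywhere to $h$. So every
  small $h$ has a solution in the unit ball of $p$, and homogeneity gives the constant.
\<close>

section \<open>Squared L2 norms as extended nonnegative integrals\<close>

text \<open>The squared L2 norm with values in \<open>ennreal\<close>: it also measures images
  \<open>\<lambda>x. bra g (\<omega> x)\<close> that need not be square integrable, and
  \<open>\<infinity>\<close> is then a legitimate value.\<close>

definition sq_integral :: "'x measure \<Rightarrow> ('x \<Rightarrow> complex) \<Rightarrow> ennreal" where
  "sq_integral M h = (\<integral>\<^sup>+x. ennreal ((cmod (h x))\<^sup>2) \<partial>M)"

lemma L2_functions_iff_sq_integral:
  "h \<in> L2_functions M \<longleftrightarrow> h \<in> borel_measurable M \<and> sq_integral M h < \<infinity>"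
  by (auto simp: L2_functions_def sq_integral_def integrable_iff_bounded)

lemma sq_integral_eq_L2_norm:
  assumes "h \<in> L2_functions M"
  shows "sq_integral M h = ennreal ((L2_norm M h)\<^sup>2)"
  using assms
  by (auto simp: L2_functions_def sq_integral_def L2_norm_def nn_integral_eq_integral)

lemma cmod_add_sq_le: "(cmod (a + b))\<^sup>2 \<le> 2 * (cmod a)\<^sup>2 + 2 * (cmod b)\<^sup>2"
proof -
  have "(cmod (a + b))\<^sup>2 \<le> (cmod a + cmod b)\<^sup>2"
    by (simp add: norm_triangle_ineq power_mono)
  also have "\<dots> \<le> 2 * (cmod a)\<^sup>2 + 2 * (cmod b)\<^sup>2"
    using sum_squares_bound[of "cmod a" "cmod b"] by (simp add: power2_sum)
  finally show ?thesis .
qed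

lemma sq_integral_add_le:
  assumes [measurable]: "h \<in> borel_measurable M" "k \<in> borel_measurable M"
  shows "sq_integral M (\<lambda>x. h x + k x) \<le> 2 * sq_integral M h + 2 * sq_integral M k"
proof -
  have "sq_integral M (\<lambda>x. h x + k x)
      \<le> (\<integral>\<^sup>+x. 2 * ennreal ((cmod (h x))\<^sup>2) + 2 * ennreal ((cmod (k x))\<^sup>2) \<partial>M)"
    unfolding sq_integral_def
  proof (rule nn_integral_mono)
    fix x
    have "ennreal ((cmod (h x + k x))\<^sup>2) \<le> ennreal (2 * (cmod (h x))\<^sup>2 + 2 * (cmod (k x))\<^sup>2)"
      by (intro ennreal_leI cmod_add_sq_le)
    then show "ennreal ((cmod (h x + k x))\<^sup>2)
        \<le> 2 * ennreal ((cmod (h x))\<^sup>2) + 2 * ennreal ((cmod (k x))\<^sup>2)"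
      by (simp add: ennreal_plus ennreal_mult)
  qed
  also have "\<dots> = 2 * sq_integral M h + 2 * sq_integral M k"
    unfolding sq_integral_def by (subst nn_integral_add) (auto simp: nn_integral_cmult)
  finally show ?thesis .
qed

lemma sq_integral_diff_le:
  assumes "h \<in> borel_measurable M" "k \<in> borel_measurable M"
  shows "sq_integral M (\<lambda>x. h x - k x) \<le> 2 * sq_integral M h + 2 * sq_integral M k"
  using sq_integral_add_le[of h M "\<lambda>x. - k x"] assms by (simp add: sq_integral_def)

lemma sq_integral_cong:
  "(\<And>x. x \<in> space M \<Longrightarrow> h x = k x) \<Longrightarrow> sq_integral M h = sq_integral M k"
  unfolding sq_integral_def by (rule nn_integral_cong) simp

lemma sq_integral_cong_AE:
  "(AE x in M. h x = k x) \<Longrightarrow> sq_integral M h = sq_integral M k"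
  unfolding sq_integral_def by (rule nn_integral_cong_AE) auto

lemma sq_integral_minus_commute:
  "sq_integral M (\<lambda>x. h x - k x) = sq_integral M (\<lambda>x. k x - h x)"
  unfolding sq_integral_def by (simp add: norm_minus_commute)

lemma sq_integral_cmult:
  assumes [measurable]: "h \<in> borel_measurable M"
  shows "sq_integral M (\<lambda>x. c * h x) = ennreal ((cmod c)\<^sup>2) * sq_integral M h"
  unfolding sq_integral_def
  by (simp add: norm_mult power_mult_distrib ennreal_mult nn_integral_cmult)

section \<open>Almost everywhere convergence and completeness of L2\<close>

text \<open>Weighting the squares by \<open>4 ^ n\<close> still leaves integrals of geometric size,
  so the weighted series is finite almost everywhere. Its terms tend to 0, which eventually forces
  \<open>cmod (u n x) \<le> (1 / 2) ^ n\<close>.\<close>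

lemma AE_summable_of_sq_integral:
  assumes [measurable]: "\<And>n. u n \<in> borel_measurable M"
    and bound: "\<And>n. sq_integral M (u n) \<le> ennreal (C / 16 ^ n)"
  shows "AE x in M. summable (\<lambda>n. cmod (u n x))"
proof -
  define a where "a n x = 4 ^ n * (cmod (u n x))\<^sup>2" for n x
  have "(\<integral>\<^sup>+x. (\<Sum>n. ennreal (a n x)) \<partial>M) = (\<Sum>n. \<integral>\<^sup>+x. ennreal (a n x) \<partial>M)"
    unfolding a_def by (rule nn_integral_suminf) measurable
  also have "\<dots> = (\<Sum>n. ennreal (4 ^ n) * sq_integral M (u n))"
    unfolding a_def sq_integral_def
    by (simp add: ennreal_mult nn_integral_cmult)
  also have "\<dots> \<le> (\<Sum>n. ennreal (\<bar>C\<bar> * (1 / 4) ^ n))"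
  proof (intro suminf_le)
    fix n
    \<comment> \<open>\<open>C\<close> carries no sign condition; its absolute value makes both
      factors nonnegative, as \<open>ennreal_mult\<close> requires.\<close>
    have "ennreal (4 ^ n) * sq_integral M (u n) \<le> ennreal (4 ^ n) * ennreal (\<bar>C\<bar> / 16 ^ n)"
      by (intro mult_left_mono order_trans[OF bound] ennreal_leI divide_right_mono) auto
    also have "\<dots> = ennreal (4 ^ n * (\<bar>C\<bar> / 16 ^ n))"
      by (rule ennreal_mult[symmetric]) auto
    also have "4 ^ n * (\<bar>C\<bar> / 16 ^ n) = \<bar>C\<bar> * (1 / 4) ^ n"
      using power_mult_distrib[of 4 "4::real" n] by (simp add: power_divide)
    finally show "ennreal (4 ^ n) * sq_integral M (u n) \<le> ennreal (\<bar>C\<bar> * (1 / 4) ^ n)" .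
  qed auto
  also have "\<dots> < \<infinity>"
    by (subst suminf_ennreal2) (auto intro!: summable_mult summable_geometric)
  finally have "AE x in M. (\<Sum>n. ennreal (a n x)) \<noteq> \<infinity>"
    by (intro nn_integral_PInf_AE) (auto simp: a_def)
  then show ?thesis
  proof eventually_elim
    case (elim x)
    then have "summable (\<lambda>n. a n x)"
      by (intro summable_suminf_not_top) (auto simp: a_def)
    then have "(\<lambda>n. a n x) \<longlonglongrightarrow> 0"
      by (rule summable_LIMSEQ_zero)
    then have "eventually (\<lambda>n. a n x < 1) sequentially"
      by (rule order_tendstoD) simp
    then have "eventually (\<lambda>n. norm (cmod (u n x)) \<le> (1 / 2) ^ n) sequentially"
    proof eventually_elim
      case (elim n)
      have "(2 ^ n * cmod (u n x))\<^sup>2 < 1\<^sup>2"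
        using elim by (simp add: a_def power_mult_distrib power_mult[symmetric] mult.commute[of n 2])
          (simp add: power_mult)
      then have "2 ^ n * cmod (u n x) < 1"
        by (rule power_less_imp_less_base) simp
      then show ?case by (simp add: field_simps)
    qed
    then show ?case
      by (rule summable_comparison_test_ev) (simp add: summable_geometric)
  qed
qed

text \<open>Only geometrically fast sequences are needed, so the quasi-triangle inequality
  with factor 2 replaces Minkowski's inequality.\<close>

lemma L2_complete_fast:
  assumes [measurable]: "\<And>n. c n \<in> borel_measurable M"
    and r_nonneg: "\<And>n. 0 \<le> r n"
    and r_Suc: "\<And>n. r (Suc n) \<le> r n / 16"
    and step: "\<And>n. sq_integral M (\<lambda>x. c (Suc n) x - c n x) \<le> ennreal (r n)"
  obtains h where "h \<in> borel_measurable M"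
    and "\<And>n. sq_integral M (\<lambda>x. h x - c n x) \<le> ennreal (4 * r n)"
proof
  \<comment> \<open>Where the sequence diverges, \<open>lim\<close> is an unspecified value;
    \<open>conv\<close> below confines this to a null set.\<close>
  define h where "h x = lim (\<lambda>n. c n x)" for x
  show [measurable]: "h \<in> borel_measurable M"
    unfolding h_def by measurable
  have "r n \<le> r 0 / 16 ^ n" for n
  proof (induction n)
    case (Suc n)
    then show ?case using r_Suc[of n] by simp
  qed simp
  then have "sq_integral M (\<lambda>x. c (Suc n) x - c n x) \<le> ennreal (r 0 / 16 ^ n)" for n
    by (intro order_trans[OF step] ennreal_leI)
  then have "AE x in M. summable (\<lambda>n. cmod (c (Suc n) x - c n x))"
    by (intro AE_summable_of_sq_integral) auto
  then have conv: "AE x in M. (\<lambda>n. c n x) \<longlonglongrightarrow> h x"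
  proof eventually_elim
    case (elim x)
    then have "summable (\<lambda>n. c (Suc n) x - c n x)"
      by (rule summable_norm_cancel)
    then have "convergent (\<lambda>n. \<Sum>i<n. c (Suc i) x - c i x)"
      by (simp add: summable_iff_convergent)
    then have "convergent (\<lambda>n. c n x - c 0 x)"
      by (simp add: sum_lessThan_telescope[where f = "\<lambda>i. c i x"])
    then have "convergent (\<lambda>n. (c n x - c 0 x) + c 0 x)"
      by (intro convergent_add convergent_const)
    then show ?case
      by (simp add: h_def convergent_LIMSEQ_iff)
  qed
  \<comment> \<open>Peeling off the first difference gives \<open>2 * r n + 8 * r (Suc n)\<close>,
    which is at most \<open>5 / 2 * r n\<close>, so the factor 4 survives the induction.\<close>
  have partial: "sq_integral M (\<lambda>x. c (n + m) x - c n x) \<le> ennreal (4 * r n)" for m n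
  proof (induction m arbitrary: n)
    case 0
    then show ?case by (simp add: sq_integral_def)
  next
    case (Suc m)
    have "sq_integral M (\<lambda>x. c (n + Suc m) x - c n x)
       = sq_integral M (\<lambda>x. (c (Suc n) x - c n x) + (c (Suc n + m) x - c (Suc n) x))"
      by simp
    also have "\<dots> \<le> 2 * sq_integral M (\<lambda>x. c (Suc n) x - c n x)
        + 2 * sq_integral M (\<lambda>x. c (Suc n + m) x - c (Suc n) x)"
      by (rule sq_integral_add_le) measurable
    also have "\<dots> \<le> 2 * ennreal (r n) + 2 * ennreal (4 * r (Suc n))"
      by (intro add_mono mult_left_mono step Suc.IH) auto
    also have "\<dots> = ennreal (2 * r n + 2 * (4 * r (Suc n)))"
      using r_nonneg by (simp add: ennreal_plus ennreal_mult)
    also have "\<dots> \<le> ennreal (4 * r n)"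
      using r_Suc[of n] r_nonneg[of n] by (intro ennreal_leI) simp
    finally show ?case .
  qed
  show "sq_integral M (\<lambda>x. h x - c n x) \<le> ennreal (4 * r n)" for n
  proof -
    \<comment> \<open>Fatou's lemma: the integrand is the almost everywhere limit of the integrands
      bounded in \<open>partial\<close>.\<close>
    have "sq_integral M (\<lambda>x. h x - c n x)
        = (\<integral>\<^sup>+x. liminf (\<lambda>m. ennreal ((cmod (c (n + m) x - c n x))\<^sup>2)) \<partial>M)"
      unfolding sq_integral_def
    proof (rule nn_integral_cong_AE, use conv in eventually_elim)
      case (elim x)
      then have "(\<lambda>m. c (n + m) x) \<longlonglongrightarrow> h x"
        unfolding add.commute[of n] by (rule LIMSEQ_ignore_initial_segment)
      then have "(\<lambda>m. ennreal ((cmod (c (n + m) x - c n x))\<^sup>2)) \<longlonglongrightarrow> ennreal ((cmod (h x - c n x))\<^sup>2)"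
        by (intro tendsto_intros)
      then show ?case
        by (intro lim_imp_Liminf[symmetric]) simp_all
    qed
    also have "\<dots> \<le> liminf (\<lambda>m. sq_integral M (\<lambda>x. c (n + m) x - c n x))"
      unfolding sq_integral_def by (rule nn_integral_liminf) measurable
    also have "\<dots> \<le> ennreal (4 * r n)"
      using Liminf_mono[OF always_eventually[OF allI[OF partial[of n]]], of sequentially]
      by (simp add: Liminf_const)
    finally show ?thesis .
  qed
qed

section \<open>The pairing and the invariant metric\<close>

text \<open>The Frechet locale only asserts that a complete invariant metric exists; here one such
  \<open>d\<close> is fixed, so that all lemmas speak of the same balls.\<close>

locale riesz_fischer_frechet = complex_frechet_space smul T
  for smul :: "complex \<Rightarrow> 'a::ab_group_add \<Rightarrow> 'a" and T :: "'a topology" +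
  fixes M :: "'x measure" and \<omega> :: "'x \<Rightarrow> 'a \<Rightarrow> complex" and d :: "'a \<Rightarrow> 'a \<Rightarrow> real"
  assumes metric: "Metric_space UNIV d"
    and invariant: "d (x + z) (y + z) = d x y"
    and mtopology: "Metric_space.mtopology UNIV d = T"
    and complete: "Metric_space.mcomplete UNIV d"
    and riesz_fischer: "riesz_fischer_map smul T M \<omega>"
begin

interpretation dm: Metric_space UNIV d
  by (rule metric)

lemma bra_measurable [measurable]: "(\<lambda>x. bra f (\<omega> x)) \<in> borel_measurable M"
  using riesz_fischer by (auto simp: riesz_fischer_map_def weakly_measurable_map_def)

lemma omega_conj_dual: "x \<in> space M \<Longrightarrow> \<omega> x \<in> conj_dual smul T"
  using riesz_fischer by (auto simp: riesz_fischer_map_def weakly_measurable_map_def)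

lemma bra_add: "x \<in> space M \<Longrightarrow> bra (f + g) (\<omega> x) = bra f (\<omega> x) + bra g (\<omega> x)"
  using omega_conj_dual[of x] by (simp add: bra_def conj_dual_def)

lemma bra_smul: "x \<in> space M \<Longrightarrow> bra (smul c f) (\<omega> x) = c * bra f (\<omega> x)"
  using omega_conj_dual[of x] by (simp add: bra_def conj_dual_def)

lemma bra_diff: "x \<in> space M \<Longrightarrow> bra (f - g) (\<omega> x) = bra f (\<omega> x) - bra g (\<omega> x)"
  using bra_add[of x "f - g" g] by (simp add: algebra_simps)

text \<open>Each \<open>\<omega> x\<close> is a continuous functional, so there is no exceptional
  null set. This identifies the image of a limit of approximate solutions.\<close>

lemma bra_tendsto:
  assumes "limitin T s g sequentially" "x \<in> space M"
  shows "(\<lambda>n. bra (s n) (\<omega> x)) \<longlonglongrightarrow> bra g (\<omega> x)"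
proof -
  have "continuous_map T euclidean (\<omega> x)"
    using omega_conj_dual[OF assms(2)] by (simp add: conj_dual_def)
  from continuous_map_limit[OF this assms(1)] show ?thesis
    unfolding bra_def by (intro tendsto_cnj) (simp add: o_def)
qed

lemma dist_diff: "d x y = d (x - y) 0"
  using invariant[of "x - y" y 0] by simp

text \<open>Invariance turns the triangle inequality through 0 into subadditivity of the distance to
  0, so differences of elements of a ball lie in the ball of twice the radius.\<close>

lemma dist_zero_diff_le: "d (x - y) 0 \<le> d x 0 + d y 0"
  using dm.triangle[of x 0 y] dm.commute[of 0 y] by (simp add: dist_diff[of x y])

section \<open>Baire category and almost openness\<close>

text \<open>Continuity of scalar multiplication at the scalar 0. The multiples of a ball by positive
  integers thus cover the space, which is the countable cover for the category argument.\<close>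

lemma absorbing:
  assumes "0 < \<epsilon>"
  obtains n where "d (smul (1 / of_nat (Suc n)) f) 0 < \<epsilon>"
proof -
  have "continuous_map euclidean T (\<lambda>c. smul c f)"
  proof -
    have "continuous_map euclidean (prod_topology euclidean T) (\<lambda>c::complex. (c, f))"
      by (intro continuous_map_pairedI) (auto simp: topspace_UNIV)
    from continuous_map_compose[OF this continuous_scale] show ?thesis
      by (simp add: o_def)
  qed
  moreover have "limitin euclidean (\<lambda>n. 1 / of_nat (Suc n)) (0::complex) sequentially"
    using LIMSEQ_Suc[OF lim_1_over_n[where 'a = complex]] by (simp add: o_def)
  ultimately have "limitin T (\<lambda>n. smul (1 / of_nat (Suc n)) f) (smul 0 f) sequentially"
    using continuous_map_limit[of euclidean T "\<lambda>c. smul c f" _ 0] by (simp add: o_def)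
  then have "limitin dm.mtopology (\<lambda>n. smul (1 / of_nat (Suc n)) f) 0 sequentially"
    by (simp add: mtopology)
  then have "eventually (\<lambda>n. d (smul (1 / of_nat (Suc n)) f) 0 < \<epsilon>) sequentially"
    using assms by (auto simp: dm.limitin_metric)
  then obtain n where "d (smul (1 / of_nat (Suc n)) f) 0 < \<epsilon>"
    unfolding eventually_sequentially by blast
  then show ?thesis by (rule that)
qed

text \<open>The Baire category argument, run by hand on nested balls: \<^term>\<open>L2_functions M\<close> is only a
  pseudometric space.\<close>

lemma dense_in_some_ball:
  assumes "0 < \<epsilon>"
  obtains (dense) n c r where "c \<in> borel_measurable M" "0 < r"
    and "\<And>h \<eta>. h \<in> borel_measurable M \<Longrightarrow> sq_integral M (\<lambda>x. h x - c x) < ennreal r \<Longrightarrow> 0 < \<eta> \<Longrightarrow>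
      \<exists>g. d (smul (1 / of_nat (Suc n)) g) 0 < \<epsilon> \<and> sq_integral M (\<lambda>x. h x - bra g (\<omega> x)) < ennreal \<eta>"
proof (rule ccontr)
  \<comment> \<open>\<open>far n h \<eta>\<close> says that the image of the
    \<open>Suc n\<close>-fold multiple of the \<open>\<epsilon>\<close>-ball stays at squared
    distance at least \<open>\<eta>\<close> from \<open>h\<close>. If the claim fails, every ball
    contains such an \<open>h\<close> for every \<open>n\<close>.\<close>
  define far where "far n h \<eta> \<longleftrightarrow> (\<forall>g. d (smul (1 / of_nat (Suc n)) g) 0 < \<epsilon> \<longrightarrow>
      \<not> sq_integral M (\<lambda>x. h x - bra g (\<omega> x)) < ennreal \<eta>)" for n h \<eta>
  assume no_ball: "\<not> thesis"
  then have ex: "\<exists>h \<eta>. h \<in> borel_measurable M \<and> sq_integral M (\<lambda>x. h x - c x) < ennreal r \<and>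
      0 < \<eta> \<and> far n h \<eta>" if "c \<in> borel_measurable M" "0 < r" for n c r
    using that no_ball dense unfolding far_def by blast
  define P where "P n cr \<longleftrightarrow> fst cr \<in> borel_measurable M \<and> sq_integral M (fst cr) < \<infinity> \<and> 0 < snd cr"
    for n :: nat and cr :: "('x \<Rightarrow> complex) \<times> real"
  \<comment> \<open>A pair consists of a centre and a squared radius. The limit of the centres will
    lie within \<open>4 * snd cr'\<close> of the new centre, so the factor 5 leaves room for a
    strict contradiction.\<close>
  define Q where "Q n cr cr' \<longleftrightarrow> sq_integral M (\<lambda>x. fst cr' x - fst cr x) \<le> ennreal (snd cr) \<and>
      snd cr' \<le> snd cr / 16 \<and> far n (fst cr') (5 * snd cr')"
    for n :: nat and cr cr' :: "('x \<Rightarrow> complex) \<times> real"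
  have "\<exists>f. \<forall>n. P n (f n) \<and> Q n (f n) (f (Suc n))"
  proof (rule dependent_nat_choice)
    have "P 0 (\<lambda>_. 0, 1)" by (simp add: P_def sq_integral_def)
    then show "\<exists>cr. P 0 cr" ..
  next
    fix cr n assume P: "P n cr"
    then obtain h \<eta> where h: "h \<in> borel_measurable M" "0 < \<eta>" "far n h \<eta>"
        "sq_integral M (\<lambda>x. h x - fst cr x) < ennreal (snd cr)"
      using ex[of "fst cr" "snd cr" n] by (auto simp: P_def)
    \<comment> \<open>The first bound gives the fast decay for \<open>L2_complete_fast\<close>; the
      second gives \<open>5 * r \<le> \<eta>\<close>, so \<open>h\<close> is still far at that
      scale.\<close>
    define r where "r = min (snd cr / 16) (\<eta> / 5)"
    have "sq_integral M (\<lambda>x. (h x - fst cr x) + fst cr x)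
        \<le> 2 * sq_integral M (\<lambda>x. h x - fst cr x) + 2 * sq_integral M (fst cr)"
      using P h by (intro sq_integral_add_le) (auto simp: P_def)
    also have "\<dots> < \<infinity>"
      using P less_trans[OF h(4) ennreal_less_top]
      by (simp add: P_def ennreal_mult_less_top)
    finally have "sq_integral M h < \<infinity>" by simp
    then have "P (Suc n) (h, r)"
      using P h by (simp add: P_def r_def)
    moreover have "far n h (5 * r)"
      using h(3) ennreal_leI[of "5 * r" \<eta>] by (fastforce simp: far_def r_def)
    then have "Q n cr (h, r)"
      using h(4) by (simp add: Q_def r_def less_imp_le)
    ultimately show "\<exists>cr'. P (Suc n) cr' \<and> Q n cr cr'" by blast
  qed
  then obtain F where F: "\<And>n. P n (F n)" "\<And>n. Q n (F n) (F (Suc n))" by blast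
  define c r where "c n = fst (F n)" and "r n = snd (F n)" for n
  have c [measurable]: "c n \<in> borel_measurable M" and c_fin: "sq_integral M (c n) < \<infinity>"
    and r: "0 < r n" and r_Suc: "r (Suc n) \<le> r n / 16"
    and step: "sq_integral M (\<lambda>x. c (Suc n) x - c n x) \<le> ennreal (r n)"
    and far: "far n (c (Suc n)) (5 * r (Suc n))" for n
    using F[of n] by (auto simp: P_def Q_def c_def r_def)
  obtain h where h [measurable]: "h \<in> borel_measurable M"
      and h_c: "\<And>n. sq_integral M (\<lambda>x. h x - c n x) \<le> ennreal (4 * r n)"
    using L2_complete_fast[of c M r, OF c less_imp_le[OF r] r_Suc step] by blast
  have "sq_integral M (\<lambda>x. (h x - c 0 x) + c 0 x)
      \<le> 2 * sq_integral M (\<lambda>x. h x - c 0 x) + 2 * sq_integral M (c 0)"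
    by (intro sq_integral_add_le) auto
  also have "\<dots> < \<infinity>"
    using le_less_trans[OF h_c ennreal_less_top, of 0] c_fin[of 0]
    by (simp add: ennreal_mult_less_top)
  finally have "h \<in> L2_functions M"
    by (simp add: L2_functions_iff_sq_integral)
  then obtain f where f: "is_solution M \<omega> h f"
    using riesz_fischer by (auto simp: riesz_fischer_map_def)
  \<comment> \<open>Some multiple of the ball contains the solution \<open>f\<close>, whose image is
    almost everywhere \<open>h\<close>. At stage \<open>n\<close> the excluded centre is
    \<open>c (Suc n)\<close>, and \<open>h\<close> is too close to it.\<close>
  obtain n where n: "d (smul (1 / of_nat (Suc n)) f) 0 < \<epsilon>"
    using absorbing[OF assms] .
  have "sq_integral M (\<lambda>x. c (Suc n) x - bra f (\<omega> x)) = sq_integral M (\<lambda>x. c (Suc n) x - h x)"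
    using f by (intro sq_integral_cong_AE) (auto simp: is_solution_def)
  also have "\<dots> \<le> ennreal (4 * r (Suc n))"
    using h_c[of "Suc n"] by (simp add: sq_integral_minus_commute)
  also have "\<dots> < ennreal (5 * r (Suc n))"
    using r[of "Suc n"] by (simp add: ennreal_less_iff)
  finally show False
    using far[of n] n by (auto simp: far_def)
qed

text \<open>Approximants of \<open>c + N * h\<close> and of \<open>c\<close> both come from the same
  multiple of a ball. Their difference approximates \<open>N * h\<close>, and dividing by
  \<open>N\<close> returns to a ball around 0.\<close>

lemma almost_open:
  assumes "0 < \<epsilon>"
  obtains \<delta> where "0 < \<delta>"
    and "\<And>h \<eta>. h \<in> borel_measurable M \<Longrightarrow> sq_integral M h < ennreal \<delta> \<Longrightarrow> 0 < \<eta> \<Longrightarrow>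
      \<exists>g. d g 0 < \<epsilon> \<and> sq_integral M (\<lambda>x. h x - bra g (\<omega> x)) < ennreal \<eta>"
proof -
  obtain n c r where c [measurable]: "c \<in> borel_measurable M" and r: "0 < r"
    and dense: "\<And>h \<eta>. h \<in> borel_measurable M \<Longrightarrow> sq_integral M (\<lambda>x. h x - c x) < ennreal r \<Longrightarrow> 0 < \<eta> \<Longrightarrow>
      \<exists>g. d (smul (1 / of_nat (Suc n)) g) 0 < \<epsilon> / 2 \<and> sq_integral M (\<lambda>x. h x - bra g (\<omega> x)) < ennreal \<eta>"
    by (rule dense_in_some_ball[OF half_gt_zero[OF assms]]) (rule that; assumption)
  define N :: real where "N = real (Suc n)"
  have N: "0 < N" and of_N: "of_nat (Suc n) = complex_of_real N" by (simp_all add: N_def)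
  show thesis
  proof
    \<comment> \<open>Squared distances scale by \<open>N\<^sup>2\<close>, so this bound keeps
      \<open>c + N * h\<close> in the ball around \<open>c\<close>.\<close>
    show "0 < r / N\<^sup>2" using r N by simp
  next
    fix h :: "'x \<Rightarrow> complex" and \<eta> :: real
    assume h [measurable]: "h \<in> borel_measurable M"
      and small: "sq_integral M h < ennreal (r / N\<^sup>2)" and \<eta>: "0 < \<eta>"
    \<comment> \<open>Chosen so that the two errors, doubled by \<open>sq_integral_diff_le\<close>
      and divided by \<open>N\<^sup>2\<close>, add up to \<open>\<eta>\<close>.\<close>
    define \<theta> where "\<theta> = \<eta> * N\<^sup>2 / 4"
    have \<theta>: "0 < \<theta>" using \<eta> N by (simp add: \<theta>_def)
    have "sq_integral M (\<lambda>x. (c x + N * h x) - c x) = ennreal (N\<^sup>2) * sq_integral M h"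
      by (simp add: sq_integral_cmult)
    also have "\<dots> < ennreal (N\<^sup>2) * ennreal (r / N\<^sup>2)"
      using small N by (intro ennreal_mult_strict_left_mono) auto
    also have "\<dots> = ennreal r"
      using N r by (simp add: ennreal_mult[symmetric])
    finally obtain g1 where g1: "d (smul (1 / of_nat (Suc n)) g1) 0 < \<epsilon> / 2"
        "sq_integral M (\<lambda>x. (c x + N * h x) - bra g1 (\<omega> x)) < ennreal \<theta>"
      using dense[of "\<lambda>x. c x + N * h x" \<theta>] \<theta> by auto
    obtain g2 where g2: "d (smul (1 / of_nat (Suc n)) g2) 0 < \<epsilon> / 2"
        "sq_integral M (\<lambda>x. c x - bra g2 (\<omega> x)) < ennreal \<theta>"
      using dense[of c \<theta>] \<theta> r by (auto simp: sq_integral_def)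
    define g where "g = smul (1 / of_nat (Suc n)) (g1 - g2)"
    have "d g 0 < \<epsilon>"
      using dist_zero_diff_le[of "smul (1 / of_nat (Suc n)) g1" "smul (1 / of_nat (Suc n)) g2"] g1(1) g2(1)
      by (simp add: g_def scale_right_diff_distrib)
    moreover have "sq_integral M (\<lambda>x. h x - bra g (\<omega> x)) < ennreal \<eta>"
    proof -
      have "sq_integral M (\<lambda>x. h x - bra g (\<omega> x)) = sq_integral M (\<lambda>x. complex_of_real (1 / N) *
          (((c x + N * h x) - bra g1 (\<omega> x)) - (c x - bra g2 (\<omega> x))))"
        using N unfolding g_def of_N
        by (intro sq_integral_cong) (simp add: bra_smul bra_diff field_simps)
      also have "\<dots> = ennreal (1 / N\<^sup>2) *
          sq_integral M (\<lambda>x. ((c x + N * h x) - bra g1 (\<omega> x)) - (c x - bra g2 (\<omega> x)))"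
        by (subst sq_integral_cmult) (auto simp: norm_divide power_divide)
      also have "\<dots> \<le> ennreal (1 / N\<^sup>2) *
          (2 * sq_integral M (\<lambda>x. (c x + N * h x) - bra g1 (\<omega> x)) + 2 * sq_integral M (\<lambda>x. c x - bra g2 (\<omega> x)))"
        by (intro mult_left_mono sq_integral_diff_le) auto
      also have "\<dots> < ennreal (1 / N\<^sup>2) * (2 * ennreal \<theta> + 2 * ennreal \<theta>)"
        using g1(2) g2(2) N
        by (intro ennreal_mult_strict_left_mono add_strict_mono) (auto simp: ennreal_mult_strict_left_mono)
      also have "\<dots> = ennreal \<eta>"
        using N \<theta> by (simp add: \<theta>_def ennreal_plus[symmetric] ennreal_mult[symmetric] del: ennreal_plus
          flip: ennreal_numeral)
      finally show ?thesis .
    qed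
    ultimately show "\<exists>g. d g 0 < \<epsilon> \<and> sq_integral M (\<lambda>x. h x - bra g (\<omega> x)) < ennreal \<eta>" by blast
  qed
qed

section \<open>Exact solutions by successive approximation\<close>

text \<open>Almost openness is applied to the remaining error again and again, with corrections
  taken from balls of geometrically shrinking radius.\<close>

lemma open_map:
  assumes "0 < \<epsilon>"
  obtains \<delta> where "0 < \<delta>"
    and "\<And>h. h \<in> borel_measurable M \<Longrightarrow> sq_integral M h < ennreal \<delta> \<Longrightarrow>
      \<exists>g. d g 0 < \<epsilon> \<and> is_solution M \<omega> h g"
proof -
  \<comment> \<open>The radii sum to \<open>\<epsilon> / 2\<close>, so a limit within
    \<open>\<epsilon> / 4\<close> of a partial sum still satisfies
    \<open>d g 0 < \<epsilon>\<close>.\<close>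
  define e where "e n = \<epsilon> / 4 * (1 / 2) ^ n" for n :: nat
  have e: "0 < e n" for n using assms by (simp add: e_def)
  have "\<exists>\<delta>>0. \<forall>h \<eta>. h \<in> borel_measurable M \<longrightarrow> sq_integral M h < ennreal \<delta> \<longrightarrow> 0 < \<eta> \<longrightarrow>
      (\<exists>g. d g 0 < e n \<and> sq_integral M (\<lambda>x. h x - bra g (\<omega> x)) < ennreal \<eta>)" for n
    by (rule almost_open[OF e[of n]]) blast
  then obtain D where D: "\<And>n. 0 < D n"
    and D_approx: "\<And>n h \<eta>. h \<in> borel_measurable M \<Longrightarrow> sq_integral M h < ennreal (D n) \<Longrightarrow> 0 < \<eta> \<Longrightarrow>
      \<exists>g. d g 0 < e n \<and> sq_integral M (\<lambda>x. h x - bra g (\<omega> x)) < ennreal \<eta>"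
    by metis
  \<comment> \<open>\<open>D n\<close> makes the next correction available;
    \<open>1 / 16 ^ n\<close> makes the errors summable almost everywhere.\<close>
  define \<delta> where "\<delta> n = min (D n) (1 / 16 ^ n)" for n
  have \<delta>: "0 < \<delta> n" for n using D by (simp add: \<delta>_def)
  show thesis
  proof
    show "0 < \<delta> 0" by (rule \<delta>)
  next
    fix h assume h [measurable]: "h \<in> borel_measurable M" and small: "sq_integral M h < ennreal (\<delta> 0)"
    \<comment> \<open>The clause for \<open>n = 0\<close> records the starting value inside the
      invariant of the dependent choice.\<close>
    have "\<exists>s. \<forall>n. sq_integral M (\<lambda>x. h x - bra (s n) (\<omega> x)) < ennreal (\<delta> n) \<and>
        (n = 0 \<longrightarrow> s n = 0) \<and> d (s (Suc n)) (s n) < e n"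
    proof -
      have "\<exists>s. \<forall>n. (sq_integral M (\<lambda>x. h x - bra (s n) (\<omega> x)) < ennreal (\<delta> n) \<and> (n = 0 \<longrightarrow> s n = 0)) \<and>
          d (s (Suc n)) (s n) < e n"
      proof (rule dependent_nat_choice)
        have "sq_integral M (\<lambda>x. h x - bra 0 (\<omega> x)) = sq_integral M h"
          using bra_smul[of _ 0 0] by (intro sq_integral_cong) simp
        then show "\<exists>s. sq_integral M (\<lambda>x. h x - bra s (\<omega> x)) < ennreal (\<delta> 0) \<and> ((0::nat) = 0 \<longrightarrow> s = 0)"
          using small by auto
      next
        fix s n
        assume "sq_integral M (\<lambda>x. h x - bra s (\<omega> x)) < ennreal (\<delta> n) \<and> (n = 0 \<longrightarrow> s = 0)"
        then have "sq_integral M (\<lambda>x. h x - bra s (\<omega> x)) < ennreal (D n)"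
          using ennreal_leI[of "\<delta> n" "D n"] by (auto simp: \<delta>_def)
        then obtain g where g: "d g 0 < e n"
            "sq_integral M (\<lambda>x. (h x - bra s (\<omega> x)) - bra g (\<omega> x)) < ennreal (\<delta> (Suc n))"
          using D_approx[of "\<lambda>x. h x - bra s (\<omega> x)" n "\<delta> (Suc n)"] \<delta> by auto
        have "sq_integral M (\<lambda>x. h x - bra (s + g) (\<omega> x)) =
            sq_integral M (\<lambda>x. (h x - bra s (\<omega> x)) - bra g (\<omega> x))"
          by (intro sq_integral_cong) (simp add: bra_add)
        moreover have "d (s + g) s = d g 0"
          using invariant[of g s 0] by (simp add: add.commute)
        ultimately show "\<exists>s'. (sq_integral M (\<lambda>x. h x - bra s' (\<omega> x)) < ennreal (\<delta> (Suc n)) \<and>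
            (Suc n = 0 \<longrightarrow> s' = 0)) \<and> d s' s < e n"
          using g by (intro exI[of _ "s + g"]) auto
      qed
      then show ?thesis by blast
    qed
    then obtain s where s_approx: "\<And>n. sq_integral M (\<lambda>x. h x - bra (s n) (\<omega> x)) < ennreal (\<delta> n)"
      and s0: "s 0 = 0" and s_step: "\<And>n. d (s (Suc n)) (s n) < e n" by blast
    have s_dist: "d (s (n + m)) (s n) \<le> 2 * e n" for n m
    proof (induction m arbitrary: n)
      case 0
      then show ?case using e[of n] by simp
    next
      case (Suc m)
      have "d (s (n + Suc m)) (s n) \<le> d (s (Suc n + m)) (s (Suc n)) + d (s (Suc n)) (s n)"
        using dm.triangle[of "s (Suc n + m)" "s (Suc n)" "s n"] by simp
      also have "\<dots> \<le> 2 * e (Suc n) + e n"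
        using Suc.IH[of "Suc n"] s_step[of n] by simp
      finally show ?case by (simp add: e_def)
    qed
    have e_lim: "e \<longlonglongrightarrow> 0"
      unfolding e_def by (intro tendsto_mult_right_zero LIMSEQ_power_zero) simp
    have "dm.MCauchy s"
      unfolding dm.MCauchy_def
    proof (intro conjI allI impI)
      fix \<gamma> :: real assume "0 < \<gamma>"
      then have "eventually (\<lambda>n. e n < \<gamma> / 4) sequentially"
        by (intro order_tendstoD(2)[OF e_lim]) simp
      then obtain N where N: "e N < \<gamma> / 4" by (auto simp: eventually_sequentially)
      have "d (s n) (s n') < \<gamma>" if "N \<le> n" "N \<le> n'" for n n'
        using s_dist[of N "n - N"] s_dist[of N "n' - N"] that N
          dm.triangle[of "s n" "s N" "s n'"] dm.commute[of "s N" "s n'"] by simp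
      then show "\<exists>N. \<forall>n n'. N \<le> n \<longrightarrow> N \<le> n' \<longrightarrow> d (s n) (s n') < \<gamma>" by blast
    qed simp
    then obtain g where g: "limitin dm.mtopology s g sequentially"
      using complete by (auto simp: dm.mcomplete_def)
    have "\<forall>\<gamma>>0. eventually (\<lambda>n. d (s n) g < \<gamma>) sequentially"
      using g by (simp add: dm.limitin_metric)
    moreover have "0 < \<epsilon> / 4" using assms by simp
    ultimately have "eventually (\<lambda>n. d (s n) g < \<epsilon> / 4) sequentially" by blast
    then obtain n where "d (s n) g < \<epsilon> / 4" unfolding eventually_sequentially by blast
    then have "d g 0 < \<epsilon>"
      using dm.triangle[of g "s n" 0] dm.commute[of g "s n"] s_dist[of 0 n] s0 assms by (simp add: e_def)
    moreover have "is_solution M \<omega> h g"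
    proof -
      \<comment> \<open>The errors tend to 0 almost everywhere, while \<open>bra_tendsto\<close>
        gives them the limit \<open>h x - bra g (\<omega> x)\<close>; uniqueness of limits makes
        \<open>g\<close> an exact solution.\<close>
      have "AE x in M. summable (\<lambda>n. cmod (h x - bra (s n) (\<omega> x)))"
      proof (rule AE_summable_of_sq_integral)
        show "sq_integral M (\<lambda>x. h x - bra (s n) (\<omega> x)) \<le> ennreal (1 / 16 ^ n)" for n
          by (rule order_trans[OF less_imp_le[OF s_approx] ennreal_leI]) (simp add: \<delta>_def)
      qed measurable
      then show ?thesis
        unfolding is_solution_def using AE_space[of M]
      proof eventually_elim
        case (elim x)
        then have "(\<lambda>n. h x - bra (s n) (\<omega> x)) \<longlonglongrightarrow> 0"
          by (blast intro: tendsto_norm_zero_cancel dest: summable_LIMSEQ_zero)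
        moreover have "(\<lambda>n. h x - bra (s n) (\<omega> x)) \<longlonglongrightarrow> h x - bra g (\<omega> x)"
          using g elim(2) by (intro tendsto_diff tendsto_const bra_tendsto) (simp_all add: mtopology)
        ultimately have "h x - bra g (\<omega> x) = 0"
          by (rule LIMSEQ_unique[symmetric])
        then show ?case by simp
      qed
    qed
    ultimately show "\<exists>g. d g 0 < \<epsilon> \<and> is_solution M \<omega> h g" by blast
  qed
qed

section \<open>The estimate for the quotient seminorm\<close>

text \<open>Homogeneity applied to \<open>open_map\<close>. A number \<open>t\<close> strictly above
  the norm replaces it, so the rescaling never divides by 0, even when \<open>h\<close> has norm
  0.\<close>

lemma solution_seminorm_bound:
  assumes p: "continuous_seminorm smul T p"
  obtains C where "0 < C"
    and "\<And>h t. h \<in> L2_functions M \<Longrightarrow> L2_norm M h < t \<Longrightarrow> \<exists>g. is_solution M \<omega> h g \<and> p g \<le> C * t"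
proof -
  have p_smul: "p (smul c x) = cmod c * p x" for c x
    using p by (simp add: continuous_seminorm_def)
  \<comment> \<open>Since \<open>d\<close> induces \<open>T\<close>, the open unit ball of
    \<open>p\<close> contains a metric ball around 0.\<close>
  have "openin T {x \<in> topspace T. p x \<in> {..<1}}"
    using p by (intro openin_continuous_map_preimage[of T euclideanreal])
      (auto simp: continuous_seminorm_def)
  moreover have "p 0 = 0"
    using p_smul[of 0 0] by simp
  ultimately have "openin dm.mtopology {x. p x < 1}" "0 \<in> {x. p x < 1}"
    by (simp_all add: mtopology topspace_UNIV)
  then obtain \<epsilon> where \<epsilon>: "0 < \<epsilon>" "dm.mball 0 \<epsilon> \<subseteq> {x. p x < 1}"
    unfolding dm.openin_mtopology by blast
  obtain \<delta> where \<delta>: "0 < \<delta>"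
    and sol: "\<And>h. h \<in> borel_measurable M \<Longrightarrow> sq_integral M h < ennreal \<delta> \<Longrightarrow>
      \<exists>g. d g 0 < \<epsilon> \<and> is_solution M \<omega> h g"
    by (rule open_map[OF \<epsilon>(1)]) (rule that; assumption)
  show thesis
  proof
    show "0 < 1 / sqrt \<delta>" using \<delta> by simp
  next
    fix h t assume h: "h \<in> L2_functions M" and t: "L2_norm M h < t"
    have nonneg: "0 \<le> L2_norm M h" by (simp add: L2_norm_def)
    with t have "0 < t" by simp
    \<comment> \<open>With this factor \<open>(k * t)\<^sup>2 = \<delta>\<close>, and undoing it
      gives \<open>1 / k = 1 / sqrt \<delta> * t\<close>.\<close>
    define k where "k = sqrt \<delta> / t"
    have k: "0 < k" using \<delta> \<open>0 < t\<close> by (simp add: k_def)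
    have [measurable]: "h \<in> borel_measurable M" using h by (simp add: L2_functions_def)
    have "sq_integral M (\<lambda>x. complex_of_real k * h x) = ennreal ((k * L2_norm M h)\<^sup>2)"
      by (simp add: sq_integral_cmult sq_integral_eq_L2_norm[OF h] power_mult_distrib ennreal_mult)
    also have "\<dots> < ennreal \<delta>"
    proof -
      have "k * L2_norm M h < k * t" using k t by simp
      then have "(k * L2_norm M h)\<^sup>2 < (k * t)\<^sup>2"
        using k nonneg by (intro power_strict_mono) auto
      then show ?thesis
        using \<delta> \<open>0 < t\<close> by (simp add: k_def ennreal_less_iff)
    qed
    finally obtain g where g: "d g 0 < \<epsilon>" "is_solution M \<omega> (\<lambda>x. complex_of_real k * h x) g"
      using sol[of "\<lambda>x. complex_of_real k * h x"] by auto
    have "p g < 1"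
      using g(1) \<epsilon>(2) by (auto simp: dm.commute[of 0])
    then have "p (smul (complex_of_real (1 / k)) g) \<le> 1 / k"
      using k by (simp add: p_smul norm_divide divide_right_mono)
    moreover have "is_solution M \<omega> h (smul (complex_of_real (1 / k)) g)"
      using g(2) AE_space[of M] unfolding is_solution_def
      by eventually_elim (use k in \<open>simp add: bra_smul\<close>)
    ultimately show "\<exists>g. is_solution M \<omega> h g \<and> p g \<le> 1 / sqrt \<delta> * t"
      by (auto simp: k_def)
  qed
qed

text \<open>Two solutions for the same \<open>h\<close> differ by an element of
  \<open>orth M \<omega>\<close>, so \<open>g\<close> lies in the class of \<open>f\<close>. The
  real infimum is bounded below by 0.\<close>

lemma quotient_seminorm_le:
  assumes p: "continuous_seminorm smul T p"
    and f: "is_solution M \<omega> h f" and g: "is_solution M \<omega> h g"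
  shows "quotient_seminorm p (f +o orth M \<omega>) \<le> p g"
  unfolding quotient_seminorm_def
proof (rule cINF_lower)
  show "bdd_below (p ` (f +o orth M \<omega>))"
    using p unfolding continuous_seminorm_def by (intro bdd_belowI[of _ 0]) blast
  have "AE x in M. bra (g - f) (\<omega> x) = 0"
    using f g AE_space[of M] unfolding is_solution_def by eventually_elim (simp add: bra_diff)
  then show "g \<in> f +o orth M \<omega>"
    unfolding elt_set_plus_def orth_def by (auto intro!: exI[of _ "g - f"])
qed

end

theorem proposition3p6:
  fixes smul :: "complex \<Rightarrow> 'a::ab_group_add \<Rightarrow> 'a"
    and T :: "'a topology"
    and M :: "'x measure"
    and \<omega> :: "'x \<Rightarrow> 'a \<Rightarrow> complex"
  assumes "complex_frechet_space smul T"
    and "sigma_finite_measure M"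
    and "riesz_fischer_map smul T M \<omega>"
  shows "\<forall>p. continuous_seminorm smul T p \<longrightarrow>
           (\<exists>C>0. \<forall>h\<in>L2_functions M. \<forall>f. is_solution M \<omega> h f \<longrightarrow>
              quotient_seminorm p (f +o orth M \<omega>) \<le> C * L2_norm M (\<lambda>x. bra f (\<omega> x)))"
proof (intro allI impI)
  fix p assume p: "continuous_seminorm smul T p"
  interpret complex_frechet_space smul T by (rule assms(1))
  obtain d where d: "Metric_space UNIV d" "\<And>x y z. d (x + z) (y + z) = d x y"
      "Metric_space.mtopology UNIV d = T" "Metric_space.mcomplete UNIV d"
    using complete_invariant_metric by blast
  interpret riesz_fischer_frechet smul T M \<omega> d
    by (intro riesz_fischer_frechet.intro riesz_fischer_frechet_axioms.intro assms d)
  obtain C where C: "0 < C"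
    and bound: "\<And>h t. h \<in> L2_functions M \<Longrightarrow> L2_norm M h < t \<Longrightarrow> \<exists>g. is_solution M \<omega> h g \<and> p g \<le> C * t"
    by (rule solution_seminorm_bound[OF p]) (rule that; assumption)
  have "quotient_seminorm p (f +o orth M \<omega>) \<le> C * L2_norm M (\<lambda>x. bra f (\<omega> x))"
    if h: "h \<in> L2_functions M" and f: "is_solution M \<omega> h f" for h f
  proof -
    have [measurable]: "h \<in> borel_measurable M" using h by (simp add: L2_functions_def)
    \<comment> \<open>Any solution has an image equal to \<open>h\<close> almost everywhere, hence
      of the same norm.\<close>
    have norm_eq: "L2_norm M (\<lambda>x. bra f (\<omega> x)) = L2_norm M h"
      unfolding L2_norm_def using f
      by (intro arg_cong[where f = sqrt] integral_cong_AE) (auto simp: is_solution_def)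
    \<comment> \<open>The bound holds for every \<open>t\<close> above the norm; letting
      \<open>t\<close> decrease, by \<open>dense_ge\<close>, reaches the norm itself.\<close>
    have "quotient_seminorm p (f +o orth M \<omega>) / C \<le> t" if t: "L2_norm M h < t" for t
    proof -
      obtain g where "is_solution M \<omega> h g" "p g \<le> C * t"
        using bound[OF h t] by blast
      then show ?thesis
        using quotient_seminorm_le[OF p f, of g] C by (simp add: field_simps)
    qed
    then have "quotient_seminorm p (f +o orth M \<omega>) / C \<le> L2_norm M h"
      by (rule dense_ge)
    then show ?thesis
      using C by (simp add: norm_eq field_simps)
  qed
  with C show "\<exists>C>0. \<forall>h\<in>L2_functions M. \<forall>f. is_solution M \<omega> h f \<longrightarrow>
      quotient_seminorm p (f +o orth M \<omega>) \<le> C * L2_norm M (\<lambda>x. bra f (\<omega> x))" by blast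
qed

end
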